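(* Let $q$ be a prime power and $n\geq 0$. The eigenvalues of the matrix $M_q(n)$ are $$(n-k)_q-(k)_q \quad\text{with multiplicity } \begin{bmatrix} n\\ k\end{bmatrix}_q,\qquad k=0,1,\ldots,n.$$
   Context: For a nonnegative integer $m$, $(m)_q=1+q+q^2+\cdots+q^{m-1}$ (so $(0)_q=0$). $B_q(n)$ is the set of all subspaces of $\mathbb{F}_q^n$ and $\begin{bmatrix} n\\ k\end{bmatrix}_q$ is the number of $k$-dimensional subspaces of $\mathbb{F}_q^n$ (the $q$-binomial coefficient). $M_q(n)$ is the complex $B_q(n)\times B_q(n)$ matrix with entries $M_q(n)(X,Y)=1$ if $Y\subseteq X$ and $\dim Y=\dim X-1$; $M_q(n)(X,Y)=q^k$ if $X\subseteq Y$, $\dim X=k$, $\dim Y=k+1$; and $M_q(n)(X,Y)=0$ otherwise. *)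

theory Defs
  imports
    "Jordan_Normal_Form.Matrix"
    "Jordan_Normal_Form.Char_Poly"
    "Jordan_Normal_Form.VS_Connect"
    "HOL-Library.Cardinality"
begin

definition q_num :: "nat \<Rightarrow> nat \<Rightarrow> nat" where
  "q_num q m = (\<Sum>i<m. q ^ i)"

text \<open>The field \<open>\<F>\<^sub>q\<close> is a finite field type \<open>'f\<close> with \<open>q = CARD('f)\<close>, and \<open>\<F>\<^sub>q\<^sup>n\<close> is the
  vector space of vectors of dimension \<open>n\<close> over \<open>'f\<close>; \<open>n = 0\<close> is allowed.\<close>

definition subspaces :: "nat \<Rightarrow> 'f::{field,finite} vec set set" where
  "subspaces n = {X. subspace class_ring X (module_vec TYPE('f) n)}"

definition sdim :: "nat \<Rightarrow> 'f::{field,finite} vec set \<Rightarrow> nat" where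
  "sdim n X = vectorspace.dim class_ring ((module_vec TYPE('f) n)\<lparr>carrier := X\<rparr>)"

definition q_binomial :: "'f::{field,finite} itself \<Rightarrow> nat \<Rightarrow> nat \<Rightarrow> nat" where
  "q_binomial _ n k = card {X \<in> (subspaces n :: 'f vec set set). sdim n X = k}"

definition Mq_entry :: "nat \<Rightarrow> 'f::{field,finite} vec set \<Rightarrow> 'f vec set \<Rightarrow> complex" where
  "Mq_entry n X Y =
    (if Y \<subseteq> X \<and> sdim n X = sdim n Y + 1 then 1
     else if X \<subseteq> Y \<and> sdim n Y = sdim n X + 1 then of_nat (CARD('f) ^ sdim n X)
     else 0)"

text \<open>Matrices are indexed by \<open>{0..<N}\<close>, so the index set \<open>B\<^sub>q(n)\<close> is enumerated by a list \<open>Xs\<close>, in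
  which every subspace is meant to occur exactly once. Rows are indexed by \<open>X\<close>, columns by \<open>Y\<close>.\<close>

definition Mq :: "nat \<Rightarrow> 'f::{field,finite} vec set list \<Rightarrow> complex mat" where
  "Mq n Xs = mat (length Xs) (length Xs) (\<lambda>(i, j). Mq_entry n (Xs ! i) (Xs ! j))"

text \<open>Such an enumeration exists:\<close>

lemma finite_subspaces: "finite (subspaces n :: 'f::{field,finite} vec set set)"
proof (rule finite_subset)
  show "(subspaces n :: 'f vec set set) \<subseteq> Pow (carrier_vec n)"
    by (auto simp: subspaces_def subspace_def submodule_def module_vec_def)
  have "(carrier_vec n :: 'f vec set) \<subseteq> vec_of_list ` {xs. set xs \<subseteq> UNIV \<and> length xs = n}"
  proof
    fix v :: "'f vec" assume "v \<in> carrier_vec n"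
    then show "v \<in> vec_of_list ` {xs. set xs \<subseteq> UNIV \<and> length xs = n}"
      by (intro image_eqI[of _ _ "list_of_vec v"]) (auto simp: vec_list)
  qed
  moreover have "finite {xs :: 'f list. set xs \<subseteq> UNIV \<and> length xs = n}"
    by (intro finite_lists_length_eq) simp
  ultimately have "finite (carrier_vec n :: 'f vec set)"
    by (meson finite_imageI finite_subset)
  then show "finite (Pow (carrier_vec n :: 'f vec set))" by simp
qed

lemma ex_enumeration_subspaces:
  "\<exists>Xs. distinct Xs \<and> set Xs = (subspaces n :: 'f::{field,finite} vec set set)"
  using finite_distinct_list[OF finite_subspaces] by blast

text \<open>The value \<open>(n - k)\<^sub>q - (k)\<^sub>q\<close>, which may be negative; meant for \<open>k \<le> n\<close>.\<close>

definition Mq_eigval :: "nat \<Rightarrow> nat \<Rightarrow> nat \<Rightarrow> complex" where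
  "Mq_eigval q n k = of_nat (q_num q (n - k)) - of_nat (q_num q k)"

end

theory Submission
  imports Defs
begin

text \<open>Let \<open>P(X, Z) = 1\<close> if \<open>X \<subseteq> Z\<close> and \<open>0\<close> otherwise, and put \<open>z = dim Z\<close>. Applied to the column
  of \<open>Z\<close>, the matrix \<open>M\<^sub>q(n)\<close> gives \<open>(d)\<^sub>q + q\<^sup>d (z - d)\<^sub>q = (z)\<^sub>q\<close> in row \<open>X \<subseteq> Z\<close> with
  \<open>d = dim X\<close>; in a row \<open>X\<close> not contained in \<open>Z\<close> it gives \<open>1\<close> if \<open>X + Z\<close> covers \<open>Z\<close> and \<open>0\<close>
  otherwise. Since \<open>Z\<close> has \<open>(n - z)\<^sub>q\<close> covers, this is the combination of \<open>(z)\<^sub>q - (n - z)\<^sub>q\<close> times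
  the column of \<open>Z\<close> and the columns of the covers of \<open>Z\<close>. As \<open>P\<close> is invertible, \<open>M\<^sub>q(n)\<close> is similar
  to a matrix that is triangular with respect to the dimension and has diagonal entries
  \<open>(z)\<^sub>q - (n - z)\<^sub>q\<close>. The multiplicities follow from the symmetry of the \<open>q\<close>-binomial
  coefficients.\<close>

section \<open>Subspaces of \<open>F_q^n\<close> as finite sets, with dimension read off from
  cardinality\<close>

lemma subspaces_iff:
  "X \<in> subspaces n \<longleftrightarrow> X \<subseteq> carrier_vec n \<and> 0\<^sub>v n \<in> X \<and> (\<forall>v\<in>X. \<forall>w\<in>X. v + w \<in> X)
     \<and> (\<forall>c. \<forall>v\<in>X. c \<cdot>\<^sub>v v \<in> X)"
  for X :: "'f::{field,finite} vec set"
proof -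
  interpret vec_space "TYPE('f)" n .
  show ?thesis
    by (auto simp: subspaces_def VectorSpace.subspace_def submodule_def module_vec_simps
        vec_vs vec_module)
qed

context
  fixes n :: nat and X :: "'f::{field,finite} vec set"
  assumes X: "X \<in> subspaces n"
begin

lemma subspaces_carrier: "v \<in> X \<Longrightarrow> v \<in> carrier_vec n"
  and subspaces_zero: "0\<^sub>v n \<in> X"
  and subspaces_add: "v \<in> X \<Longrightarrow> w \<in> X \<Longrightarrow> v + w \<in> X"
  and subspaces_smult: "v \<in> X \<Longrightarrow> c \<cdot>\<^sub>v v \<in> X"
  using X by (auto simp: subspaces_iff)

lemma subspaces_diff:
  assumes "v \<in> X" "w \<in> X"
  shows "v - w \<in> X"
proof -
  have "v - w = v + (-1) \<cdot>\<^sub>v w"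
    using subspaces_carrier[OF assms(1)] subspaces_carrier[OF assms(2)] by (intro eq_vecI) auto
  then show ?thesis
    using assms subspaces_add subspaces_smult by metis
qed

lemma finite_subspace: "finite X"
proof -
  have "finite (carrier_vec n :: 'f vec set)"
  proof (rule finite_surj)
    show "finite ({0..<n} \<rightarrow>\<^sub>E (UNIV :: 'f set))" by (auto intro: finite_PiE)
    show "carrier_vec n \<subseteq> vec n ` ({0..<n} \<rightarrow>\<^sub>E (UNIV :: 'f set))"
    proof
      fix v :: "'f vec" assume "v \<in> carrier_vec n"
      then show "v \<in> vec n ` ({0..<n} \<rightarrow>\<^sub>E (UNIV :: 'f set))"
        by (intro image_eqI[of _ _ "restrict (vec_index v) {0..<n}"]) auto
    qed
  qed
  then show ?thesis using X subspaces_iff finite_subset by metis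
qed

text \<open>Each vector of \<open>X\<close> has unique coordinates in a basis \<open>B\<close>, and
  coordinate vectors are the extensional functions on \<open>B\<close>. Later counts and dimension
  comparisons are made through this cardinality.\<close>

lemma card_subspace: "card X = CARD('f) ^ sdim n X"
proof -
  interpret vec_space "TYPE('f)" n .
  have sub: "VectorSpace.subspace class_ring X V" using X by (simp add: subspaces_def)
  interpret W: vectorspace class_ring "vs X" by (rule subspace_is_vs[OF sub])
  \<comment> \<open>The finite set \<open>X\<close> spans itself.\<close>
  have fd: "W.fin_dim"
    unfolding W.fin_dim_def
    by (intro exI[of _ X]) (use W.in_own_span[of X] W.span_is_subset2[of X] finite_subspace in auto)
  obtain B where B: "finite B" "W.basis B" using W.finite_basis_exists[OF fd] by blast
  then have BX: "B \<subseteq> X" by (auto simp: W.basis_def)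
  have "bij_betw (\<lambda>a. W.lincomb a B) (B \<rightarrow>\<^sub>E (UNIV :: 'f set)) X"
  proof -
    have u: "v \<in> X \<Longrightarrow> \<exists>!a. a \<in> B \<rightarrow>\<^sub>E UNIV \<and> W.lincomb a B = v" for v
      using W.basis_criterion[of B] B BX by auto
    have c: "W.lincomb a B \<in> X" for a
      using W.lincomb_closed[of B a] BX by auto
    show ?thesis
      unfolding bij_betw_def inj_on_def using u c by (auto simp: image_iff) metis+
  qed
  then have "card X = card (B \<rightarrow>\<^sub>E (UNIV :: 'f set))"
    by (simp add: bij_betw_same_card)
  also have "\<dots> = CARD('f) ^ card B" using B by (simp add: card_PiE)
  also have "card B = sdim n X" using W.dim_basis[OF B] by (simp add: sdim_def)
  finally show ?thesis .
qed

end

lemma one_less_card_field: "1 < CARD('f::{field,finite})"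
proof -
  have "card {0, 1 :: 'f} \<le> CARD('f)" by (intro card_mono) auto
  then show ?thesis by simp
qed

lemma sdim_iff_card:
  fixes X Y :: "'f::{field,finite} vec set"
  assumes "X \<in> subspaces n" "Y \<in> subspaces n"
  shows "sdim n X = sdim n Y \<longleftrightarrow> card X = card Y"
    and "sdim n X \<le> sdim n Y \<longleftrightarrow> card X \<le> card Y"
  using assms one_less_card_field[where 'f = 'f] by (simp_all add: card_subspace)

lemma sdim_mono:
  fixes X Y :: "'f::{field,finite} vec set"
  assumes "X \<in> subspaces n" "Y \<in> subspaces n" "X \<subseteq> Y"
  shows "sdim n X \<le> sdim n Y"
  using assms by (simp add: sdim_iff_card card_mono finite_subspace)

text \<open>Equal dimensions mean equal finite cardinalities, so an inclusion cannot be
  proper.\<close>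

lemma subspace_eqI:
  fixes X Y :: "'f::{field,finite} vec set"
  assumes "X \<in> subspaces n" "Y \<in> subspaces n" "X \<subseteq> Y" "sdim n X = sdim n Y"
  shows "X = Y"
  using assms by (metis sdim_iff_card(1) card_subset_eq finite_subspace)

lemma carrier_vec_subspaces: "(carrier_vec n :: 'f::{field,finite} vec set) \<in> subspaces n"
  by (auto simp: subspaces_iff)

lemma zero_subspaces: "{0\<^sub>v n :: 'f::{field,finite} vec} \<in> subspaces n"
  by (auto simp: subspaces_iff)

lemma sdim_carrier_vec: "sdim n (carrier_vec n :: 'f::{field,finite} vec set) = n"
proof -
  interpret vec_space "TYPE('f)" n .
  have "V\<lparr>carrier := carrier_vec n\<rparr> = V" by (simp add: module_vec_def)
  then show ?thesis unfolding sdim_def by (simp only: dim_is_n)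
qed

lemma sdim_le: "X \<in> subspaces n \<Longrightarrow> sdim n X \<le> n"
  for X :: "'f::{field,finite} vec set"
  using sdim_mono[OF _ carrier_vec_subspaces, of X] by (auto simp: sdim_carrier_vec subspaces_iff)

lemma sdim_eq_0_iff:
  fixes X :: "'f::{field,finite} vec set"
  assumes "X \<in> subspaces n"
  shows "sdim n X = 0 \<longleftrightarrow> X = {0\<^sub>v n}"
proof
  assume "sdim n X = 0"
  then have "card X = 1" using card_subspace[OF assms] by simp
  then show "X = {0\<^sub>v n}" using subspaces_zero[OF assms] by (auto simp: card_1_singleton_iff)
next
  assume "X = {0\<^sub>v n}"
  then have "CARD('f) ^ sdim n X = 1" using card_subspace[OF assms] by simp
  then show "sdim n X = 0" using one_less_card_field[where 'f = 'f] by simp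
qed

section \<open>Adjoining a vector to a subspace\<close>

text \<open>This is \<open>X + span {v}\<close>, written as an image of
  \<open>X \<times> UNIV\<close> so that its size follows from injectivity of the
  parametrization.\<close>

definition adjoin :: "'f::{field,finite} vec set \<Rightarrow> 'f vec \<Rightarrow> 'f vec set" where
  "adjoin X v = (\<lambda>(x, c). x + c \<cdot>\<^sub>v v) ` (X \<times> UNIV)"

context
  fixes n :: nat and X :: "'f::{field,finite} vec set" and v :: "'f vec"
  assumes X: "X \<in> subspaces n" and v: "v \<in> carrier_vec n"
begin

lemma adjoin_subspaces: "adjoin X v \<in> subspaces n"
  unfolding subspaces_iff
proof (intro conjI allI ballI)
  show "adjoin X v \<subseteq> carrier_vec n"
  proof
    fix u assume "u \<in> adjoin X v"
    then obtain x c where "x \<in> X" "u = x + c \<cdot>\<^sub>v v" by (auto simp: adjoin_def)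
    then show "u \<in> carrier_vec n" using subspaces_carrier[OF X] v by simp
  qed
  have "0\<^sub>v n = 0\<^sub>v n + 0 \<cdot>\<^sub>v v" by (intro eq_vecI) (use v in auto)
  then show "0\<^sub>v n \<in> adjoin X v"
    unfolding adjoin_def using subspaces_zero[OF X] by (intro image_eqI[of _ _ "(0\<^sub>v n, 0)"]) auto
next
  fix u w assume "u \<in> adjoin X v" "w \<in> adjoin X v"
  then obtain x c y d where *: "x \<in> X" "y \<in> X" "u = x + c \<cdot>\<^sub>v v" "w = y + d \<cdot>\<^sub>v v"
    by (auto simp: adjoin_def)
  have "u + w = (x + y) + (c + d) \<cdot>\<^sub>v v"
    using *(3,4) v subspaces_carrier[OF X *(1)] subspaces_carrier[OF X *(2)]
    by (intro eq_vecI) (auto simp: algebra_simps)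
  then show "u + w \<in> adjoin X v"
    unfolding adjoin_def using * subspaces_add[OF X] by (intro image_eqI[of _ _ "(x + y, c + d)"]) auto
next
  fix a u assume "u \<in> adjoin X v"
  then obtain x c where *: "x \<in> X" "u = x + c \<cdot>\<^sub>v v" by (auto simp: adjoin_def)
  have "a \<cdot>\<^sub>v u = a \<cdot>\<^sub>v x + (a * c) \<cdot>\<^sub>v v"
    using *(2) v subspaces_carrier[OF X *(1)] by (intro eq_vecI) (auto simp: algebra_simps)
  then show "a \<cdot>\<^sub>v u \<in> adjoin X v"
    unfolding adjoin_def using * subspaces_smult[OF X] by (intro image_eqI[of _ _ "(a \<cdot>\<^sub>v x, a * c)"]) auto
qed

lemma subset_adjoin: "X \<subseteq> adjoin X v"
proof
  fix x assume "x \<in> X"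
  moreover have "x = x + 0 \<cdot>\<^sub>v v"
    using subspaces_carrier[OF X \<open>x \<in> X\<close>] v by (intro eq_vecI) auto
  ultimately show "x \<in> adjoin X v"
    unfolding adjoin_def by (intro image_eqI[of _ _ "(x, 0)"]) auto
qed

lemma mem_adjoin: "v \<in> adjoin X v"
proof -
  have "v = 0\<^sub>v n + 1 \<cdot>\<^sub>v v" using v by (intro eq_vecI) auto
  then show ?thesis
    unfolding adjoin_def using subspaces_zero[OF X] by (intro image_eqI[of _ _ "(0\<^sub>v n, 1)"]) auto
qed

lemma adjoin_subset:
  assumes "Y \<in> subspaces n" "X \<subseteq> Y" "v \<in> Y"
  shows "adjoin X v \<subseteq> Y"
proof
  fix u assume "u \<in> adjoin X v"
  then obtain x c where "x \<in> X" "u = x + c \<cdot>\<^sub>v v" by (auto simp: adjoin_def)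
  then show "u \<in> Y" using assms by (auto simp: subspaces_iff)
qed

text \<open>For \<open>v\<close> outside \<open>X\<close> the parametrization is injective, so the
  cardinality is multiplied by \<open>q\<close>, which raises the dimension by one.\<close>

lemma sdim_adjoin:
  assumes "v \<notin> X"
  shows "sdim n (adjoin X v) = sdim n X + 1"
proof -
  have "inj_on (\<lambda>(x, c). x + c \<cdot>\<^sub>v v) (X \<times> UNIV)"
  proof (rule inj_onI, clarify)
    fix x c y d assume xy: "x \<in> X" "y \<in> X" and eq: "x + c \<cdot>\<^sub>v v = y + d \<cdot>\<^sub>v v"
    note car = subspaces_carrier[OF X xy(1)] subspaces_carrier[OF X xy(2)] v
    have nth: "x $ i + c * v $ i = y $ i + d * v $ i" if "i < n" for i
      using arg_cong[OF eq, of "\<lambda>u. u $ i"] car that by simp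
    have "c = d"
    proof (rule ccontr)
      assume "c \<noteq> d"
      \<comment> \<open>Two representations with different coefficients would make \<open>v\<close>
        a multiple of \<open>y - x\<close>, hence an element of \<open>X\<close>.\<close>
      then have "v = inverse (c - d) \<cdot>\<^sub>v (y - x)"
        using car nth by (intro eq_vecI) (auto simp: field_simps)
      then show False
        using assms subspaces_smult[OF X subspaces_diff[OF X xy(2,1)]] by metis
    qed
    with nth car show "x = y \<and> c = d" by (auto intro!: eq_vecI)
  qed
  then have "card (adjoin X v) = card X * CARD('f)"
    by (simp add: adjoin_def card_image card_cartesian_product)
  then have "CARD('f) ^ sdim n (adjoin X v) = CARD('f) ^ (sdim n X + 1)"
    by (simp add: card_subspace[OF X] card_subspace[OF adjoin_subspaces])
  then show ?thesis
    using one_less_card_field[where 'f = 'f] power_inject_exp by blast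
qed

text \<open>A cover of \<open>X\<close> is determined by any one of its vectors outside
  \<open>X\<close>: the adjoined space lies in \<open>Y\<close> and has the same dimension. Hence
  distinct covers are disjoint outside \<open>X\<close>.\<close>

lemma cover_eq_adjoin:
  assumes "Y \<in> subspaces n" "X \<subseteq> Y" "v \<in> Y" "v \<notin> X" "sdim n Y = sdim n X + 1"
  shows "Y = adjoin X v"
  using subspace_eqI[OF adjoin_subspaces assms(1) adjoin_subset[OF assms(1-3)]] sdim_adjoin[OF assms(4)]
    assms(5) by simp

end

section \<open>q-numbers and the counting of covers, hyperplanes and subspaces\<close>

lemma q_num_mult: "q_num q m * (q - 1) = q ^ m - 1" if "q > 0"
proof -
  obtain r where "q = Suc r" using \<open>q > 0\<close> gr0_implies_Suc by blast
  then have "q_num q m * (q - 1) + 1 = q ^ m"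
    by (induction m) (auto simp: q_num_def algebra_simps)
  then show ?thesis by simp
qed

text \<open>With \<open>k = dim X\<close> and \<open>k + m = dim Z\<close> this makes the row sum
  for \<open>X \<subseteq> Z\<close> depend on \<open>dim Z\<close> only.\<close>

lemma q_num_add: "q_num q (k + m) = q_num q k + q ^ k * q_num q m"
  by (induction m) (auto simp: q_num_def power_add algebra_simps)

text \<open>Let \<open>d = dim X\<close> and \<open>z = dim Z\<close>. The sets
  \<open>Y - X\<close>, for the covers \<open>Y\<close> of \<open>X\<close> inside \<open>Z\<close>,
  partition \<open>Z - X\<close> into blocks of size \<open>q^(d+1) - q^d\<close>. Their number is
  therefore \<open>(q^z - q^d) / (q^d (q - 1))\<close>, which is \<open>(z - d)_q\<close>.\<close>

lemma card_covers:
  fixes X Z :: "'f::{field,finite} vec set"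
  assumes X: "X \<in> subspaces n" and Z: "Z \<in> subspaces n" and XZ: "X \<subseteq> Z"
  shows "card {Y \<in> subspaces n. X \<subseteq> Y \<and> Y \<subseteq> Z \<and> sdim n Y = sdim n X + 1}
    = q_num (CARD('f)) (sdim n Z - sdim n X)"
    (is "card ?C = q_num ?q _")
proof -
  note q = one_less_card_field[where 'f = 'f]
  have uni: "Y = adjoin X v" if "Y \<in> ?C" "v \<in> Y - X" for Y v
    using cover_eq_adjoin[OF X, of v Y] subspaces_carrier[of Y n v] that by auto
  have union: "\<Union> ((\<lambda>Y. Y - X) ` ?C) = Z - X"
  proof (intro equalityI subsetI)
    fix v assume v: "v \<in> Z - X"
    then have vc: "v \<in> carrier_vec n" using subspaces_carrier[OF Z] by blast
    have "adjoin X v \<in> ?C"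
      using v adjoin_subspaces[OF X vc] subset_adjoin[OF X vc] adjoin_subset[OF X vc Z XZ]
        sdim_adjoin[OF X vc] by auto
    then show "v \<in> \<Union> ((\<lambda>Y. Y - X) ` ?C)" using mem_adjoin[OF X vc] v by blast
  qed auto
  have ne: "Y - X \<noteq> {}" if "Y \<in> ?C" for Y
    using that by auto
  \<comment> \<open>The partition counts the blocks \<open>Y - X\<close>; injectivity transfers the
    count to the covers \<open>Y\<close> themselves.\<close>
  have inj: "inj_on (\<lambda>Y. Y - X) ?C"
  proof (rule inj_onI)
    fix Y Y' assume *: "Y \<in> ?C" "Y' \<in> ?C" "Y - X = Y' - X"
    obtain v where v: "v \<in> Y - X" using ne[OF *(1)] by blast
    then have "v \<in> Y' - X" using *(3) by simp
    then show "Y = Y'" using uni[OF *(1) v] uni[OF *(2), of v] by simp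
  qed
  have dle: "sdim n X \<le> sdim n Z" using sdim_mono[OF X Z XZ] .
  have step: "?q ^ (sdim n X + 1) - ?q ^ sdim n X = ?q ^ sdim n X * (?q - 1)"
    by (simp add: diff_mult_distrib mult.commute)
  have "(?q ^ (sdim n X + 1) - ?q ^ sdim n X) * card ((\<lambda>Y. Y - X) ` ?C)
      = card (\<Union> ((\<lambda>Y. Y - X) ` ?C))"
  proof (rule card_partition)
    show "finite ((\<lambda>Y. Y - X) ` ?C)"
      by (intro finite_imageI finite_subset[OF _ finite_subspaces[of n]]) blast
    show "finite (\<Union> ((\<lambda>Y. Y - X) ` ?C))" unfolding union using finite_subspace[OF Z] by simp
    show "card c = ?q ^ (sdim n X + 1) - ?q ^ sdim n X" if "c \<in> (\<lambda>Y. Y - X) ` ?C" for c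
    proof -
      from that obtain Y where Y: "Y \<in> subspaces n" "X \<subseteq> Y" "sdim n Y = sdim n X + 1" "c = Y - X"
        by blast
      show ?thesis
        unfolding Y(4) card_Diff_subset[OF finite_subspace[OF X] Y(2)]
          card_subspace[OF X] card_subspace[OF Y(1)] Y(3) ..
    qed
    fix c1 c2 assume c: "c1 \<in> (\<lambda>Y. Y - X) ` ?C" "c2 \<in> (\<lambda>Y. Y - X) ` ?C" "c1 \<noteq> c2"
    then obtain Y1 Y2 where Y: "Y1 \<in> ?C" "Y2 \<in> ?C" "c1 = Y1 - X" "c2 = Y2 - X" by blast
    show "c1 \<inter> c2 = {}"
    proof (rule ccontr)
      assume "c1 \<inter> c2 \<noteq> {}"
      then obtain v where "v \<in> c1" "v \<in> c2" by blast
      then have "Y1 = Y2" using uni[OF Y(1), of v] uni[OF Y(2), of v] Y(3,4) by simp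
      then show False using c(3) Y(3,4) by simp
    qed
  qed
  also have "\<dots> = ?q ^ sdim n Z - ?q ^ sdim n X"
    unfolding union card_Diff_subset[OF finite_subspace[OF X] XZ] card_subspace[OF X] card_subspace[OF Z] ..
  also have "\<dots> = ?q ^ sdim n X * (?q ^ (sdim n Z - sdim n X) - 1)"
    using dle by (simp add: diff_mult_distrib2 flip: power_add)
  also have "\<dots> = ?q ^ sdim n X * ((?q - 1) * q_num ?q (sdim n Z - sdim n X))"
    using q_num_mult[of ?q "sdim n Z - sdim n X"] by (simp add: mult.commute)
  finally have "(?q ^ sdim n X * (?q - 1)) * card ?C
      = (?q ^ sdim n X * (?q - 1)) * q_num ?q (sdim n Z - sdim n X)"
    unfolding card_image[OF inj] step by (simp only: mult.assoc)
  moreover have "?q ^ sdim n X * (?q - 1) \<noteq> 0" using q by simp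
  ultimately show ?thesis by (simp only: mult_cancel1) simp
qed

text \<open>The q-binomial coefficient of \<open>dim Z\<close> over \<open>k\<close>, relative to a
  subspace \<open>Z\<close> so that an induction on \<open>dim Z\<close> can keep the ambient
  \<open>n\<close> fixed.\<close>

definition num_subspaces :: "nat \<Rightarrow> 'f::{field,finite} vec set \<Rightarrow> nat \<Rightarrow> nat" where
  "num_subspaces n Z k = card {Y \<in> subspaces n. Y \<subseteq> Z \<and> sdim n Y = k}"

definition q_fact :: "nat \<Rightarrow> nat \<Rightarrow> nat" where
  "q_fact q m = (\<Prod>i<m. q_num q (Suc i))"

lemma q_fact_0 [simp]: "q_fact q 0 = 1"
  and q_fact_Suc: "q_fact q (Suc m) = q_fact q m * q_num q (Suc m)"
  by (simp_all add: q_fact_def)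

lemma q_num_pos: "q > 0 \<Longrightarrow> m > 0 \<Longrightarrow> q_num q m > 0"
  by (auto simp: q_num_def intro!: sum_pos)

lemma q_fact_pos: "q > 0 \<Longrightarrow> q_fact q m > 0"
  by (auto simp: q_fact_def intro!: prod_pos q_num_pos)

context
  fixes n :: nat and Z :: "'f::{field,finite} vec set"
  assumes Z: "Z \<in> subspaces n"
begin

lemma num_subspaces_0: "num_subspaces n Z 0 = 1"
proof -
  have "{Y \<in> subspaces n. Y \<subseteq> Z \<and> sdim n Y = 0} = {{0\<^sub>v n}}"
    using subspaces_zero[OF Z] zero_subspaces sdim_eq_0_iff by auto
  then show ?thesis by (simp add: num_subspaces_def)
qed

lemma num_subspaces_sdim: "num_subspaces n Z (sdim n Z) = 1"
proof -
  have "{Y \<in> subspaces n. Y \<subseteq> Z \<and> sdim n Y = sdim n Z} = {Z}"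
    using Z subspace_eqI[OF _ Z] by auto
  then show ?thesis by (simp add: num_subspaces_def)
qed

text \<open>Double counting of the pairs \<open>X \<subseteq> Y\<close> inside \<open>Z\<close> with
  dimensions \<open>k\<close> and \<open>k + 1\<close>. The number \<open>h\<close> of hyperplanes
  of \<open>Y\<close> is left open, to be supplied by an induction hypothesis.\<close>

lemma double_count_covers:
  assumes "k < sdim n Z"
    and hyper: "\<And>Y. Y \<in> subspaces n \<Longrightarrow> Y \<subseteq> Z \<Longrightarrow> sdim n Y = Suc k \<Longrightarrow> num_subspaces n Y k = h"
  shows "num_subspaces n Z k * q_num (CARD('f)) (sdim n Z - k) = num_subspaces n Z (Suc k) * h"
proof -
  let ?A = "{Y \<in> subspaces n. Y \<subseteq> Z \<and> sdim n Y = k}"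
  let ?B = "{Y \<in> subspaces n. Y \<subseteq> Z \<and> sdim n Y = Suc k}"
  have fin: "finite ?A" "finite ?B"
    by (auto intro: finite_subset[OF _ finite_subspaces[of n]])
  have 1: "card {Y \<in> ?B. X \<subseteq> Y} = q_num (CARD('f)) (sdim n Z - k)" if "X \<in> ?A" for X
  proof -
    have "{Y \<in> ?B. X \<subseteq> Y} = {Y \<in> subspaces n. X \<subseteq> Y \<and> Y \<subseteq> Z \<and> sdim n Y = sdim n X + 1}"
      using that by auto
    then show ?thesis using card_covers[of X n Z] that Z by simp
  qed
  have 2: "card {X \<in> ?A. X \<subseteq> Y} = h" if "Y \<in> ?B" for Y
  proof -
    have "{X \<in> ?A. X \<subseteq> Y} = {X \<in> subspaces n. X \<subseteq> Y \<and> sdim n X = k}"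
      using that by auto
    then show ?thesis using hyper[of Y] that by (simp add: num_subspaces_def)
  qed
  have "num_subspaces n Z k * q_num (CARD('f)) (sdim n Z - k) = (\<Sum>X\<in>?A. card {Y \<in> ?B. X \<subseteq> Y})"
    using 1 by (simp add: num_subspaces_def)
  also have "\<dots> = h * card ?B"
    by (rule sum_multicount[OF fin]) (use 2 in blast)
  finally show ?thesis by (simp add: num_subspaces_def mult.commute)
qed

end

text \<open>Counting hyperplanes is the case \<open>k = z - 1\<close>. The induction on the dimension supplies it for
  the proper subspaces, which is what the double count of covers needs.\<close>

lemma num_subspaces_fact:
  fixes Z :: "'f::{field,finite} vec set"
  assumes "Z \<in> subspaces n" "k \<le> sdim n Z"
  shows "num_subspaces n Z k * (q_fact (CARD('f)) k * q_fact (CARD('f)) (sdim n Z - k))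
    = q_fact (CARD('f)) (sdim n Z)"
  using assms
proof (induction "sdim n Z" arbitrary: Z k rule: less_induct)
  case less
  note Z = \<open>Z \<in> subspaces n\<close>
  let ?q = "CARD('f)" and ?z = "sdim n Z"
  from \<open>k \<le> ?z\<close> show ?case
  proof (induction k)
    case 0
    then show ?case using num_subspaces_0[OF Z] by simp
  next
    case (Suc j)
    show ?case
    \<comment> \<open>For \<open>Suc j = ?z\<close> the only candidate for \<open>Y\<close> is
      \<open>Z\<close> itself, which the induction hypothesis does not reach.\<close>
    proof (cases "Suc j = ?z")
      case True
      then show ?thesis using num_subspaces_sdim[OF Z] by simp
    next
      case False
      with Suc have lt: "Suc j < ?z" by simp
      have hyper: "num_subspaces n Y j = q_num ?q (Suc j)"
        if Y: "Y \<in> subspaces n" "Y \<subseteq> Z" "sdim n Y = Suc j" for Y :: "'f vec set"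
      proof -
        have "num_subspaces n Y j * (q_fact ?q j * q_fact ?q (sdim n Y - j)) = q_fact ?q (sdim n Y)"
          using less(1)[of Y j] lt Y by simp
        \<comment> \<open>The remaining factor is \<open>q_fact ?q 1 = 1\<close>.\<close>
        then have "q_fact ?q j * num_subspaces n Y j = q_fact ?q j * q_num ?q (Suc j)"
          using Y(3) by (simp add: q_fact_Suc mult.commute) (simp add: q_num_def)
        then show ?thesis using q_fact_pos[of ?q j] by simp
      qed
      have dc: "num_subspaces n Z j * q_num ?q (?z - j) = num_subspaces n Z (Suc j) * q_num ?q (Suc j)"
        by (rule double_count_covers[OF Z]) (use lt in simp, fact hyper)
      have "?z - j = Suc (?z - Suc j)" using lt by simp
      then have f: "q_fact ?q (?z - j) = q_fact ?q (?z - Suc j) * q_num ?q (?z - j)"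
        using q_fact_Suc[of ?q "?z - Suc j"] by simp
      have "num_subspaces n Z (Suc j) * (q_fact ?q (Suc j) * q_fact ?q (?z - Suc j))
          = (num_subspaces n Z (Suc j) * q_num ?q (Suc j)) * (q_fact ?q j * q_fact ?q (?z - Suc j))"
        by (simp add: q_fact_Suc)
      also have "\<dots> = (num_subspaces n Z j * q_num ?q (?z - j)) * (q_fact ?q j * q_fact ?q (?z - Suc j))"
        unfolding dc ..
      also have "\<dots> = num_subspaces n Z j * (q_fact ?q j * q_fact ?q (?z - j))"
        unfolding f by (simp only: mult_ac)
      also have "\<dots> = q_fact ?q ?z" using Suc by simp
      finally show ?thesis .
    qed
  qed
qed

text \<open>The product formula at codimension one leaves the quotient of two consecutive
  q-factorials. In dimension 0 there is no hyperplane, in agreement with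
  \<open>(0)_q = 0\<close>.\<close>

lemma card_hyperplanes:
  fixes X :: "'f::{field,finite} vec set"
  assumes X: "X \<in> subspaces n"
  shows "card {Y \<in> subspaces n. Y \<subseteq> X \<and> sdim n X = sdim n Y + 1} = q_num (CARD('f)) (sdim n X)"
proof (cases "sdim n X")
  case 0
  then show ?thesis by (simp add: q_num_def)
next
  case (Suc j)
  let ?q = "CARD('f)"
  have "num_subspaces n X j * (q_fact ?q j * q_fact ?q (sdim n X - j)) = q_fact ?q (sdim n X)"
    using num_subspaces_fact[OF X, of j] Suc by simp
  then have "q_fact ?q j * num_subspaces n X j = q_fact ?q j * q_num ?q (Suc j)"
    using Suc by (simp add: q_fact_Suc mult.commute) (simp add: q_num_def)
  then have "num_subspaces n X j = q_num ?q (Suc j)"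
    using q_fact_pos[of ?q j] by simp
  moreover have "{Y \<in> subspaces n. Y \<subseteq> X \<and> sdim n X = sdim n Y + 1}
      = {Y \<in> subspaces n. Y \<subseteq> X \<and> sdim n Y = j}"
    using Suc by auto
  ultimately show ?thesis using Suc by (simp add: num_subspaces_def)
qed

lemma q_binomial_fact:
  assumes "k \<le> n"
  shows "q_binomial TYPE('f::{field,finite}) n k * (q_fact (CARD('f)) k * q_fact (CARD('f)) (n - k))
    = q_fact (CARD('f)) n"
proof -
  have "q_binomial TYPE('f) n k = num_subspaces n (carrier_vec n :: 'f vec set) k"
    unfolding q_binomial_def num_subspaces_def by (rule arg_cong[of _ _ card]) (auto simp: subspaces_iff)
  then show ?thesis
    using num_subspaces_fact[OF carrier_vec_subspaces, where 'f = 'f, of k n] assms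
    by (simp add: sdim_carrier_vec)
qed

lemma q_binomial_pos:
  assumes "k \<le> n"
  shows "q_binomial TYPE('f::{field,finite}) n k > 0"
  using q_binomial_fact[OF assms, where 'f = 'f] q_fact_pos[of "CARD('f)" n]
  by (intro Nat.gr0I) auto

text \<open>The q-factorial denominator is symmetric in \<open>k\<close> and \<open>n - k\<close>.
  This is what reconciles a diagonal indexed by codimension with multiplicities indexed by
  dimension.\<close>

lemma q_binomial_symmetric:
  assumes "k \<le> n"
  shows "q_binomial TYPE('f::{field,finite}) n (n - k) = q_binomial TYPE('f) n k"
proof -
  let ?c = "q_fact (CARD('f)) k * q_fact (CARD('f)) (n - k)"
  have "?c * q_binomial TYPE('f) n (n - k) = ?c * q_binomial TYPE('f) n k"
    using q_binomial_fact[OF assms, where 'f = 'f] q_binomial_fact[of "n - k" n, where 'f = 'f] assms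
    by (simp add: mult_ac)
  moreover have "?c > 0" by (simp add: q_fact_pos)
  ultimately show ?thesis by simp
qed

section \<open>The intertwining relation with the containment matrix\<close>

lemma Int_subspaces:
  fixes X Y :: "'f::{field,finite} vec set"
  shows "X \<in> subspaces n \<Longrightarrow> Y \<in> subspaces n \<Longrightarrow> X \<inter> Y \<in> subspaces n"
  by (auto simp: subspaces_iff)

lemma card_of_bool_mem:
  assumes "\<And>y. y \<in> S \<Longrightarrow> y = x"
  shows "card S = of_bool (x \<in> S)"
proof (cases "x \<in> S")
  case True
  then have "S = {x}" using assms by blast
  then show ?thesis by simp
next
  case False
  then have "S = {}" using assms by blast
  then show ?thesis by simp
qed

text \<open>Both sets are empty or singletons, namely \<open>{X \<inter> Z}\<close> and \<open>{X + Z}\<close>.\<close>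

lemma card_lower_eq_card_upper:
  fixes X Z :: "'f::{field,finite} vec set"
  assumes X: "X \<in> subspaces n" and Z: "Z \<in> subspaces n" and XZ: "\<not> X \<subseteq> Z"
  shows "card {Y \<in> subspaces n. Y \<subseteq> X \<and> Y \<subseteq> Z \<and> sdim n X = sdim n Y + 1}
    = card {W \<in> subspaces n. X \<subseteq> W \<and> Z \<subseteq> W \<and> sdim n W = sdim n Z + 1}"
    (is "card ?A = card ?B")
proof -
  \<comment> \<open>If \<open>X + Z\<close> covers \<open>Z\<close>, it equals
    \<open>adjoin Z v\<close> for any such \<open>v\<close>; likewise \<open>v\<close> generates
    \<open>X\<close> over \<open>X \<inter> Z\<close> if that is a hyperplane of
    \<open>X\<close>.\<close>
  obtain v where v: "v \<in> X" "v \<notin> Z" using XZ by blast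
  have vc: "v \<in> carrier_vec n" using subspaces_carrier[OF X v(1)] .
  note I = Int_subspaces[OF X Z]
  have A: "Y = X \<inter> Z" if "Y \<in> ?A" for Y
  proof (rule subspace_eqI[OF _ I])
    show "Y \<in> subspaces n" "Y \<subseteq> X \<inter> Z" using that by auto
    have "sdim n Y \<le> sdim n (X \<inter> Z)" using that by (intro sdim_mono I) auto
    moreover have "sdim n (X \<inter> Z) < sdim n X"
      using sdim_mono[OF I X] subspace_eqI[OF I X] v by fastforce
    ultimately show "sdim n Y = sdim n (X \<inter> Z)" using that by simp
  qed
  have B: "W = adjoin Z v" if "W \<in> ?B" for W
    using that v by (intro cover_eq_adjoin[OF Z vc]) auto
  have "adjoin Z v \<in> ?B" if "X \<inter> Z \<in> ?A"
  proof -
    have "X = adjoin (X \<inter> Z) v"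
      using that v X by (intro cover_eq_adjoin[OF I vc]) auto
    also have "\<dots> \<subseteq> adjoin Z v" by (auto simp: adjoin_def)
    finally show ?thesis
      using adjoin_subspaces[OF Z vc] subset_adjoin[OF Z vc] sdim_adjoin[OF Z vc v(2)] by simp
  qed
  moreover have "X \<inter> Z \<in> ?A" if "adjoin Z v \<in> ?B"
  proof -
    \<comment> \<open>Modular law: if \<open>x = z + c v\<close> with \<open>x\<close> and
      \<open>v\<close> in \<open>X\<close>, then \<open>z\<close> lies in
      \<open>X \<inter> Z\<close>.\<close>
    have "X \<subseteq> adjoin (X \<inter> Z) v"
    proof
      fix x assume x: "x \<in> X"
      with that obtain z c where z: "z \<in> Z" "x = z + c \<cdot>\<^sub>v v" by (auto simp: adjoin_def)
      have "z = x - c \<cdot>\<^sub>v v"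
        using z(2) vc subspaces_carrier[OF Z z(1)] by (intro eq_vecI) auto
      then have "z \<in> X" using subspaces_diff[OF X x subspaces_smult[OF X v(1)]] by simp
      then show "x \<in> adjoin (X \<inter> Z) v"
        unfolding adjoin_def using z by (intro image_eqI[of _ _ "(z, c)"]) auto
    qed
    then have "X = adjoin (X \<inter> Z) v"
      using adjoin_subset[OF I vc X _ v(1)] by auto
    then have "sdim n X = sdim n (X \<inter> Z) + 1"
      using sdim_adjoin[OF I vc] v(2) by auto
    then show ?thesis using I by simp
  qed
  ultimately have eq: "X \<inter> Z \<in> ?A \<longleftrightarrow> adjoin Z v \<in> ?B" by (rule iffI)
  have "card ?A = of_bool (X \<inter> Z \<in> ?A)" by (rule card_of_bool_mem) (rule A)
  also have "\<dots> = of_bool (adjoin Z v \<in> ?B)" unfolding eq ..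
  also have "\<dots> = card ?B" by (rule card_of_bool_mem[symmetric]) (rule B)
  finally show ?thesis .
qed

text \<open>The matrix of \<open>M_q(n)\<close> in the basis of containment columns. Since
  \<open>dim Z \<le> n\<close>, the diagonal value is \<open>(z)_q - (n - z)_q\<close> with
  \<open>z = dim Z\<close>.\<close>

definition Tq_entry :: "nat \<Rightarrow> 'f::{field,finite} vec set \<Rightarrow> 'f vec set \<Rightarrow> complex" where
  "Tq_entry n W Z = (if W = Z then Mq_eigval (CARD('f)) n (n - sdim n Z) else 0)
     + of_bool (Z \<subseteq> W \<and> sdim n W = sdim n Z + 1)"

lemma sum_of_bool_card:
  assumes "finite S"
  shows "(\<Sum>Y\<in>S. of_bool (P Y)) = (of_nat (card {Y \<in> S. P Y}) :: complex)"
  using assms by (simp add: of_bool_def sum.If_cases Int_def)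

text \<open>Entry \<open>(X, Z)\<close> of \<open>M P = P T\<close>. Both sides become
  cardinalities: hyperplanes and covers of \<open>X\<close> inside \<open>Z\<close> on the left,
  covers of \<open>Z\<close> containing \<open>X\<close> on the right.\<close>

lemma Mq_intertwine:
  fixes X Z :: "'f::{field,finite} vec set"
  assumes X: "X \<in> subspaces n" and Z: "Z \<in> subspaces n"
  shows "(\<Sum>Y\<in>subspaces n. Mq_entry n X Y * of_bool (Y \<subseteq> Z))
    = (\<Sum>W\<in>subspaces n. of_bool (X \<subseteq> W) * Tq_entry n W Z)"
proof -
  let ?q = "CARD('f)" and ?S = "subspaces n :: 'f vec set set"
  let ?lower = "{Y \<in> ?S. Y \<subseteq> X \<and> Y \<subseteq> Z \<and> sdim n X = sdim n Y + 1}"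
  let ?mid = "{Y \<in> ?S. X \<subseteq> Y \<and> Y \<subseteq> Z \<and> sdim n Y = sdim n X + 1}"
  let ?upper = "{W \<in> ?S. X \<subseteq> W \<and> Z \<subseteq> W \<and> sdim n W = sdim n Z + 1}"
  \<comment> \<open>The two nonzero cases of \<open>Mq_entry\<close> exclude each other by
    dimension, so the case distinction splits into a sum of indicators.\<close>
  have "(\<Sum>Y\<in>?S. Mq_entry n X Y * of_bool (Y \<subseteq> Z))
      = (\<Sum>Y\<in>?S. of_bool (Y \<subseteq> X \<and> Y \<subseteq> Z \<and> sdim n X = sdim n Y + 1)
          + of_nat (?q ^ sdim n X) * of_bool (X \<subseteq> Y \<and> Y \<subseteq> Z \<and> sdim n Y = sdim n X + 1))"
    by (rule sum.cong) (auto simp: Mq_entry_def)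
  also have "\<dots> = of_nat (card ?lower + ?q ^ sdim n X * card ?mid)"
    by (simp only: sum.distrib sum_of_bool_card finite_subspaces of_nat_add of_nat_mult
        flip: sum_distrib_left)
  finally have L: "(\<Sum>Y\<in>?S. Mq_entry n X Y * of_bool (Y \<subseteq> Z))
      = of_nat (card ?lower + ?q ^ sdim n X * card ?mid)" .
  have "(\<Sum>W\<in>?S. of_bool (X \<subseteq> W) * Tq_entry n W Z)
      = (\<Sum>W\<in>?S. (if W = Z then of_bool (X \<subseteq> Z) * Mq_eigval ?q n (n - sdim n Z) else 0)
          + of_bool (X \<subseteq> W \<and> Z \<subseteq> W \<and> sdim n W = sdim n Z + 1))"
    by (rule sum.cong) (auto simp: Tq_entry_def)
  also have "\<dots> = of_bool (X \<subseteq> Z) * Mq_eigval ?q n (n - sdim n Z) + of_nat (card ?upper)"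
    using Z by (simp only: sum.distrib sum_of_bool_card finite_subspaces sum.delta) simp
  finally have R: "(\<Sum>W\<in>?S. of_bool (X \<subseteq> W) * Tq_entry n W Z)
      = of_bool (X \<subseteq> Z) * Mq_eigval ?q n (n - sdim n Z) + of_nat (card ?upper)" .
  show ?thesis
  proof (cases "X \<subseteq> Z")
    case True
    have dz: "sdim n X \<le> sdim n Z" using sdim_mono[OF X Z True] .
    have "?lower = {Y \<in> ?S. Y \<subseteq> X \<and> sdim n X = sdim n Y + 1}" using True by auto
    then have lower: "card ?lower = q_num ?q (sdim n X)" using card_hyperplanes[OF X] by simp
    have mid: "card ?mid = q_num ?q (sdim n Z - sdim n X)" using card_covers[OF X Z True] .
    \<comment> \<open>Covers of \<open>Z\<close> in the whole space are covers inside
      \<open>carrier_vec n\<close>, to which \<open>card_covers\<close> applies.\<close>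
    have "?upper = {W \<in> ?S. Z \<subseteq> W \<and> W \<subseteq> carrier_vec n \<and> sdim n W = sdim n Z + 1}"
      using True by (auto simp: subspaces_iff)
    then have upper: "card ?upper = q_num ?q (n - sdim n Z)"
      using card_covers[OF Z carrier_vec_subspaces] Z by (simp add: sdim_carrier_vec subspaces_iff)
    have "card ?lower + ?q ^ sdim n X * card ?mid = q_num ?q (sdim n Z)"
      unfolding lower mid using q_num_add[of ?q "sdim n X" "sdim n Z - sdim n X"] dz by simp
    then show ?thesis
      unfolding L R upper using True sdim_le[OF Z] by (simp add: Mq_eigval_def)
  next
    case False
    then have mid: "?mid = {}" by auto
    show ?thesis
      unfolding L R mid card_lower_eq_card_upper[OF X Z False] using False by simp
  qed
qed

section \<open>Similarity, root multiplicities and the triangular form\<close>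

text \<open>A trivial kernel makes the square matrix \<open>P\<close> invertible, so
  \<open>A = P B Q\<close> with \<open>Q\<close> its inverse.\<close>

lemma char_poly_intertwine:
  fixes A B P :: "'a::field mat"
  assumes A: "A \<in> carrier_mat N N" and B: "B \<in> carrier_mat N N" and P: "P \<in> carrier_mat N N"
    and AP: "A * P = P * B"
    and inj: "\<And>v. v \<in> carrier_vec N \<Longrightarrow> P *\<^sub>v v = 0\<^sub>v N \<Longrightarrow> v = 0\<^sub>v N"
  shows "char_poly A = char_poly B"
proof -
  have "det P \<noteq> 0" using det_0_iff_vec_prod_zero[OF P] inj by blast
  then obtain Q where Q: "Q \<in> carrier_mat N N" "P * Q = 1\<^sub>m N" "Q * P = 1\<^sub>m N"
    using det_non_zero_imp_unit[OF P, of "()"] by (auto simp: Units_def ring_mat_simps)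
  have "A = A * (P * Q)" using A Q by simp
  also have "\<dots> = P * B * Q" using assoc_mult_mat[OF A P Q(1)] AP by simp
  finally have "A = P * B * Q" .
  with A B P Q have "similar_mat A B" by (intro similar_matI[of A B P Q N]) (simp_all del: assoc_mult_mat)
  then show ?thesis by (rule char_poly_similar)
qed

lemma order_prod_list_linear:
  "Polynomial.order a (\<Prod>b\<leftarrow>bs. [:- b, 1:]) = length (filter (\<lambda>b. b = a) bs)"
  for a :: "'a::field"
proof (induction bs)
  case (Cons b bs)
  have "(\<Prod>b\<leftarrow>bs. [:- b, 1:]) \<noteq> 0" by (auto simp: prod_list_zero_iff)
  moreover have "Polynomial.order a [:- b, 1:] = (if b = a then 1 else 0)"
    using order_power_n_n[of a 1] by (auto simp: order_0I)
  ultimately show ?case using Cons by (subst list.map, subst prod_list.Cons, subst order_mult) (auto simp del: mult_pCons_left)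
qed simp

lemma strict_mono_q_num: "q > 0 \<Longrightarrow> strict_mono (q_num q)"
  by (simp add: strict_mono_Suc_iff q_num_def)

text \<open>As \<open>k\<close> grows, \<open>(n - k)_q\<close> strictly decreases and
  \<open>(k)_q\<close> strictly increases. Thus different \<open>k\<close> never share an
  eigenvalue, and multiplicities do not merge.\<close>

lemma inj_on_Mq_eigval:
  assumes "q > 0"
  shows "inj_on (Mq_eigval q n) {0..n}"
proof (rule linorder_inj_onI')
  fix k l assume kl: "k \<in> {0..n}" "l \<in> {0..n}" "k < l"
  note m = strict_monoD[OF strict_mono_q_num[OF assms]]
  have "q_num q (n - l) < q_num q (n - k)" "q_num q k < q_num q l" using kl by (auto intro!: m)
  \<comment> \<open>Negative terms are moved across so that the comparison takes place in the
    naturals.\<close>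
  then have "of_nat (q_num q (n - k) + q_num q l) \<noteq> (of_nat (q_num q (n - l) + q_num q k) :: complex)"
    unfolding of_nat_eq_iff by simp
  then show "Mq_eigval q n k \<noteq> Mq_eigval q n l"
    by (auto simp: Mq_eigval_def algebra_simps)
qed

lemma sum_nth_distinct:
  "distinct xs \<Longrightarrow> (\<Sum>i = 0..<length xs. f (xs ! i)) = sum f (set xs)"
  by (simp add: sum.distinct_set_conv_list sum_list_sum_nth)

text \<open>The given order \<open>Xs\<close> indexes \<open>M_q(n)\<close> and the rows of
  \<open>P\<close>; a second order \<open>Ys\<close>, sorted by codimension, indexes the columns of
  \<open>P\<close> and all of \<open>T\<close>. Hence \<open>T\<close> can be triangular for any
  enumeration \<open>Xs\<close>.\<close>

lemma char_poly_Mq: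
  fixes Xs :: "'f::{field,finite} vec set list"
  assumes dist: "distinct Xs" and set: "set Xs = subspaces n"
  obtains Ys where "distinct Ys" "set Ys = (subspaces n :: 'f vec set set)"
    "char_poly (Mq n Xs) = (\<Prod>a\<leftarrow>map (\<lambda>Z. Mq_eigval (CARD('f)) n (n - sdim n Z)) Ys. [:- a, 1:])"
proof -
  \<comment> \<open>Larger dimensions come first: an off-diagonal entry of \<open>T\<close> needs a
    row space covering the column space, and so lies above the diagonal.\<close>
  define Ys where "Ys = sort_key (\<lambda>X. n - sdim n X) Xs"
  define N where "N = length Xs"
  define P where "P = mat N N (\<lambda>(i, j). of_bool (Xs ! i \<subseteq> Ys ! j) :: complex)"
  define T where "T = mat N N (\<lambda>(i, j). Tq_entry n (Ys ! i) (Ys ! j))"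
  have Ys: "distinct Ys" "set Ys = subspaces n" "length Ys = N"
    using dist set by (auto simp: Ys_def N_def)
  have mem: "Xs ! i \<in> subspaces n" "Ys ! i \<in> subspaces n" if "i < N" for i
    using that set Ys by (metis N_def nth_mem)+
  have carr: "Mq n Xs \<in> carrier_mat N N" "P \<in> carrier_mat N N" "T \<in> carrier_mat N N"
    by (auto simp: Mq_def P_def T_def N_def)
  have MP: "Mq n Xs * P = P * T"
  proof (rule eq_matI)
    fix i j assume "i < dim_row (P * T)" "j < dim_col (P * T)"
    then have ij: "i < N" "j < N" using carr by auto
    have "(Mq n Xs * P) $$ (i, j) = (\<Sum>k = 0..<N. Mq_entry n (Xs ! i) (Xs ! k) * of_bool (Xs ! k \<subseteq> Ys ! j))"
      using ij by (simp add: Mq_def P_def N_def[symmetric] scalar_prod_def)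
    also have "\<dots> = (\<Sum>Y\<in>subspaces n. Mq_entry n (Xs ! i) Y * of_bool (Y \<subseteq> Ys ! j))"
      unfolding N_def set[symmetric] by (rule sum_nth_distinct[OF dist])
    also have "\<dots> = (\<Sum>W\<in>subspaces n. of_bool (Xs ! i \<subseteq> W) * Tq_entry n W (Ys ! j))"
      using Mq_intertwine mem ij by blast
    also have "\<dots> = (\<Sum>k = 0..<N. of_bool (Xs ! i \<subseteq> Ys ! k) * Tq_entry n (Ys ! k) (Ys ! j))"
      unfolding Ys(2,3)[symmetric] by (rule sum_nth_distinct[OF Ys(1), symmetric])
    also have "\<dots> = (P * T) $$ (i, j)"
      using ij by (simp add: P_def T_def scalar_prod_def)
    finally show "(Mq n Xs * P) $$ (i, j) = (P * T) $$ (i, j)" .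
  qed (use carr in auto)
  \<comment> \<open>The row of \<open>P\<close> belonging to \<open>Ys ! j\<close> sums
    \<open>v\<close> over the superspaces of \<open>Ys ! j\<close>. By induction on codimension the
    proper ones contribute 0, which leaves \<open>v $ j\<close>.\<close>
  have inj: "v = 0\<^sub>v N" if v: "v \<in> carrier_vec N" and Pv: "P *\<^sub>v v = 0\<^sub>v N" for v
  proof (rule eq_vecI)
    show "dim_vec v = dim_vec (0\<^sub>v N :: complex vec)" using v by simp
    have "v $ j = 0" if "j < N" for j
      using that
    proof (induction "n - sdim n (Ys ! j)" arbitrary: j rule: less_induct)
      case less
      obtain i where i: "i < N" "Xs ! i = Ys ! j"
        using mem(2)[OF less(2)] set by (metis N_def in_set_conv_nth)
      have zero: "of_bool (Ys ! j \<subseteq> Ys ! l) * v $ l = 0" if l: "l \<in> {0..<N} - {j}" for l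
      proof (cases "Ys ! j \<subseteq> Ys ! l")
        case True
        have lN: "l < N" "l \<noteq> j" using l by auto
        then have "Ys ! j \<noteq> Ys ! l" using Ys less(2) by (simp add: nth_eq_iff_index_eq)
        then have "sdim n (Ys ! j) < sdim n (Ys ! l)"
          using sdim_mono[OF mem(2) mem(2) True] subspace_eqI[OF mem(2) mem(2) True] less(2) lN
          by fastforce
        then have "n - sdim n (Ys ! l) < n - sdim n (Ys ! j)"
          using sdim_le[OF mem(2)[OF lN(1)]] by simp
        then show ?thesis using less(1) lN by simp
      qed simp
      have "0 = (P *\<^sub>v v) $ i" using Pv i by simp
      also have "\<dots> = (\<Sum>l = 0..<N. of_bool (Ys ! j \<subseteq> Ys ! l) * v $ l)"
        using i v by (simp add: P_def scalar_prod_def)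
      also have "\<dots> = v $ j"
        using less(2) zero by (subst sum.remove[of _ j]) (auto intro!: sum.neutral)
      finally show ?case by simp
    qed
    then show "v $ j = 0\<^sub>v N $ j" if "j < dim_vec (0\<^sub>v N :: complex vec)" for j
      using that by simp
  qed
  have "upper_triangular T"
  proof (rule upper_triangularI)
    fix i j assume ij: "j < i" "i < dim_row T"
    then have iN: "i < N" "j < N" by (auto simp: T_def)
    \<comment> \<open>Below the diagonal the row space has dimension at most that of the column
      space, so it is not a cover of it.\<close>
    have "n - sdim n (Ys ! j) \<le> n - sdim n (Ys ! i)"
      using sorted_nth_mono[of "map (\<lambda>X. n - sdim n X) Ys" j i] ij iN Ys(3)
      by (simp add: Ys_def)
    moreover have "sdim n (Ys ! i) \<le> n" "sdim n (Ys ! j) \<le> n"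
      using sdim_le mem(2) iN by blast+
    moreover have "Ys ! i \<noteq> Ys ! j" using Ys ij iN by (simp add: nth_eq_iff_index_eq)
    ultimately show "T $$ (i, j) = 0" using iN by (auto simp: T_def Tq_entry_def)
  qed
  then have "char_poly T = (\<Prod>a\<leftarrow>diag_mat T. [:- a, 1:])"
    by (rule char_poly_upper_triangular[OF carr(3)])
  moreover have "diag_mat T = map (\<lambda>Z. Mq_eigval (CARD('f)) n (n - sdim n Z)) Ys"
    by (rule nth_equalityI) (auto simp: diag_mat_def T_def Tq_entry_def Ys)
  moreover have "char_poly (Mq n Xs) = char_poly T"
    using char_poly_intertwine[OF carr(1,3,2) MP inj] .
  ultimately show thesis using that[OF Ys(1,2)] by simp
qed

section \<open>Eigenvalues and their algebraic multiplicities\<close>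

theorem theorem1p1:
  fixes n q :: nat
    and Xs :: "'f::{field,finite} vec set list"
  assumes "q = CARD('f)"
    and "distinct Xs"
    and "set Xs = subspaces n"
  shows "{x. eigenvalue (Mq n Xs) x} = Mq_eigval q n ` {0..n} \<and>
         (\<forall>k\<in>{0..n}. Polynomial.order (Mq_eigval q n k) (char_poly (Mq n Xs)) = q_binomial TYPE('f) n k)"
proof -
  obtain Ys where Ys: "distinct Ys" "set Ys = (subspaces n :: 'f vec set set)"
    and cp: "char_poly (Mq n Xs) = (\<Prod>a\<leftarrow>map (\<lambda>Z. Mq_eigval q n (n - sdim n Z)) Ys. [:- a, 1:])"
    using char_poly_Mq[OF assms(2,3)] assms(1) by metis
  have mult: "Polynomial.order (Mq_eigval q n k) (char_poly (Mq n Xs)) = q_binomial TYPE('f) n k"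
    if k: "k \<in> {0..n}" for k
  proof -
    \<comment> \<open>By injectivity the \<open>k\<close>-th value occurs on the diagonal exactly at
      the subspaces of dimension \<open>n - k\<close>.\<close>
    have "Mq_eigval q n (n - sdim n Z) = Mq_eigval q n k \<longleftrightarrow> sdim n Z = n - k"
      if "Z \<in> set Ys" for Z
      using inj_on_eq_iff[OF inj_on_Mq_eigval[of q n], of "n - sdim n Z" k] sdim_le[of Z n] k that Ys assms(1)
      by auto
    then have "Polynomial.order (Mq_eigval q n k) (char_poly (Mq n Xs))
        = length (filter (\<lambda>Z. sdim n Z = n - k) Ys)"
      unfolding cp order_prod_list_linear by (simp add: filter_map comp_def cong: filter_cong)
    also have "\<dots> = q_binomial TYPE('f) n (n - k)"
      unfolding distinct_length_filter[OF Ys(1)] q_binomial_def Ys(2)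
      by (rule arg_cong[of _ _ card]) auto
    finally show ?thesis using q_binomial_symmetric k by simp
  qed
  have M: "Mq n Xs \<in> carrier_mat (length Xs) (length Xs)" by (simp add: Mq_def)
  have "eigenvalue (Mq n Xs) x \<longleftrightarrow> x \<in> Mq_eigval q n ` {0..n}" for x
  proof
    assume "eigenvalue (Mq n Xs) x"
    then have "poly (char_poly (Mq n Xs)) x = 0" using eigenvalue_root_char_poly[OF M] by simp
    then have "x \<in> (\<lambda>Z. Mq_eigval q n (n - sdim n Z)) ` set Ys"
      unfolding cp poly_prod_list by (auto simp: prod_list_zero_iff)
    then show "x \<in> Mq_eigval q n ` {0..n}" by auto
  next
    assume "x \<in> Mq_eigval q n ` {0..n}"
    then obtain k where k: "k \<in> {0..n}" "x = Mq_eigval q n k" by blast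
    \<comment> \<open>The multiplicity is a positive q-binomial coefficient, so every listed value
      is a root.\<close>
    then have "Polynomial.order x (char_poly (Mq n Xs)) \<noteq> 0"
      using mult[OF k(1)] q_binomial_pos[of k n, where 'f = 'f] by simp
    then show "eigenvalue (Mq n Xs) x"
      using eigenvalue_root_char_poly[OF M] order_root by blast
  qed
  then show ?thesis using mult by blast
qed

end
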